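(* For any given $\rho_S,\rho_C\in(0,1]$, the algorithm FATS (run from start iteration $t_0=1$ with stability parameters $\rho_S,\rho_C$) is $\min\{\rho_S,1\}$-sample-level TV-stable and $\min\{\rho_C,1\}$-client-level TV-stable.
   Context: **Setting.** There are $M$ clients; client $k\in[M]=\{1,\dots,M\}$ holds a local dataset $\mathcal D_k$ of $N$ data points from a data universe $\mathcal X$. $\Theta$ is the parameter space and $f(\theta;X)$ a pointwise loss, differentiable in $\theta$. For a set of clients $\mathcal C$, $\mathcal D(\mathcal C)$ denotes all data held by the clients in $\mathcal C$ ($\mathcal D$ for short). $\Delta(\cdot,\cdot)$ is symmetric difference. A learning algorithm $\mathcal L$ maps the data to a random algorithmic state in $\Theta\times\mathcal S$ (output model together with internal state: intermediate local and global models, sampled mini-batches, sampled client multisets); $\mathcal L(\mathcal D)$ also denotes its distribution. $\operatorname{TV}(P,Q)=\sup_{\mathcal Z}|P(\mathcal Z)-Q(\mathcal Z)|$ over measurable $\mathcal Z$. **TV-stability.** $\mathcal L$ is $\rho$-sample-level TV-stable if $\sup_{\mathcal D,\mathcal D':|\Delta(\mathcal D,\mathcal D')|=1}\operatorname{TV}(\mathcal L(\mathcal D),\mathcal L(\mathcal D'))\le\rho$, and $\rho$-client-level TV-stable if $\sup_{\mathcal C,\mathcal C':|\Delta(\mathcal C,\mathcal C')|=1}\operatorname{TV}(\mathcal L(\mathcal D(\mathcal C)),\mathcal L(\mathcal D(\mathcal C')))\le\rho$. Here one of the two datasets (client sets) is the full one, with $M$ clients holding $N$ samples each, and the other is obtained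 from it by deleting one sample of one client (respectively, one client). **FATS.** Parameters: horizon $T=R\cdot E$, local iteration number $E$, learning rate $\eta$, stability parameters $\rho_S,\rho_C$. Put $K=\rho_C E M/T$ and $b=\rho_S N/(\rho_C E)$ (assumed to be positive integers), and $\mathcal I_E=\{sE+1: s=0,1,\dots,\lfloor (T-1)/E\rfloor\}$ (first iterations of communication rounds). The initial global model $\theta^{(0)}$ is fixed. For $t=1,\dots,T$: (i) if $t\in\mathcal I_E$, the server samples a multiset $\mathcal P^{(t)}$ of $K$ clients uniformly with replacement from the available clients, and sends them the latest global model, so that $\theta_k^{(t-1)}=\theta^{(t-1)}$ for $k\in\mathcal P^{(t)}$; if $t\notin\mathcal I_E$, $\mathcal P^{(t)}$ is the multiset of the current round; (ii) each $k\in\mathcal P^{(t)}$ samples a mini-batch $\mathcal B_k^{(t)}$ of size $b$ from its local dataset uniformly without replacement and sets $\theta_k^{(t)}=\theta_k^{(t-1)}-\eta\frac1b\sum_{X\in\mathcal B_k^{(t)}}\nabla f(\theta_k^{(t-1)};X)$; (iii) if $t\bmod E=0$, the server sets $\theta^{(t)}=\frac1K\sum_{k\in\mathcal P^{(t)}}\theta_k^{(t)}$. The output is $\theta^{(T)}$. All samplings are independent. When FATS is run on the dataset with one sample or one client deleted, sampling is from the remaining samples/clients while $K$ and $b$ keep the values computed from the original $M,N$. *)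

theory Defs
  imports "HOL-Probability.Probability" "HOL-Library.Monad_Syntax"
begin

section \<open>Total variation distance\<close>

definition tv_dist :: "'s measure \<Rightarrow> 's measure \<Rightarrow> real" where
  "tv_dist P Q = (SUP Z\<in>sets P. \<bar>measure P Z - measure Q Z\<bar>)"


section \<open>Federated datasets and TV-stability\<close>

text \<open>
  A federated dataset maps each available client to its local dataset; its domain is the set of
  available clients. Local datasets are multisets, so repeated data points are allowed. The type
  \<open>'x\<close> is the data universe. The data held by a set \<open>C\<close> of clients is \<open>D |` C\<close>.
\<close>

type_synonym 'x dataset = "nat \<rightharpoonup> 'x multiset"

definition full_dataset :: "nat \<Rightarrow> nat \<Rightarrow> 'x dataset \<Rightarrow> bool" where
  "full_dataset M N D \<longleftrightarrow> dom D = {1..M} \<and> (\<forall>k\<in>{1..M}. size (the (D k)) = N)"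

definition delete_sample :: "nat \<Rightarrow> 'x \<Rightarrow> 'x dataset \<Rightarrow> 'x dataset" where
  "delete_sample k X D = D(k \<mapsto> the (D k) - {#X#})"

text \<open>
  In both notions the first of the two neighbouring inputs is the full one and the second one
  arises from it by a single deletion. The supremum over all such pairs being at most \<open>\<rho>\<close> is
  written as a bound for every pair.
\<close>

definition sample_level_TV_stable ::
    "nat \<Rightarrow> nat \<Rightarrow> ('x dataset \<Rightarrow> 's measure) \<Rightarrow> real \<Rightarrow> bool" where
  "sample_level_TV_stable M N L \<rho> \<longleftrightarrow>
     (\<forall>D. full_dataset M N D \<longrightarrow>
        (\<forall>k\<in>{1..M}. \<forall>X. X \<in># the (D k) \<longrightarrow> tv_dist (L D) (L (delete_sample k X D)) \<le> \<rho>))"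

definition client_level_TV_stable ::
    "nat \<Rightarrow> nat \<Rightarrow> ('x dataset \<Rightarrow> 's measure) \<Rightarrow> real \<Rightarrow> bool" where
  "client_level_TV_stable M N L \<rho> \<longleftrightarrow>
     (\<forall>D. full_dataset M N D \<longrightarrow>
        (\<forall>k\<in>{1..M}. tv_dist (L (D |` {1..M})) (L (D |` ({1..M} - {k}))) \<le> \<rho>))"


section \<open>The algorithm FATS\<close>

definition grad :: "('a::euclidean_space \<Rightarrow> real) \<Rightarrow> 'a \<Rightarrow> 'a" where
  "grad g \<theta> = (THE v. GDERIV g \<theta> :> v)"

text \<open>
  Drawing \<open>n\<close> points without replacement. If \<open>A\<close> has fewer than \<open>n\<close> elements, the draws after its
  exhaustion follow the unspecified law \<open>pmf_of_multiset {#}\<close>; likewise the law of the client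
  sampling is unspecified if no client is available.
\<close>

primrec sample_without_replacement :: "nat \<Rightarrow> 'x multiset \<Rightarrow> 'x multiset pmf" where
  "sample_without_replacement 0 A = return_pmf {#}"
| "sample_without_replacement (Suc n) A = do {
     X \<leftarrow> pmf_of_multiset A;
     B \<leftarrow> sample_without_replacement n (A - {#X#});
     return_pmf (add_mset X B)
   }"

definition sample_with_replacement :: "nat \<Rightarrow> 'c set \<Rightarrow> 'c multiset pmf" where
  "sample_with_replacement n C = map_pmf mset (replicate_pmf n (pmf_of_set C))"

definition round_starts :: "nat \<Rightarrow> nat \<Rightarrow> nat set" where
  "round_starts T E = {s * E + 1 | s. s \<le> (T - 1) div E}"

text \<open>
  What iteration \<open>t\<close> produces: the client multiset $P^{(t)}$, the mini-batches $B_k^{(t)}$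
  (empty for clients that do not take part), the local models $\theta_k^{(t)}$, and the latest
  global model after iteration \<open>t\<close>.
\<close>

datatype ('a, 'x) iteration = Iteration
  (sampled_clients: "nat multiset")
  (batches: "nat \<Rightarrow> 'x multiset")
  (local_models: "nat \<rightharpoonup> 'a")
  (global_model: 'a)

text \<open>
  The mini-batch and the local model are indexed by the client, so a client that occurs several
  times in the client multiset makes one local update; its local model is then counted with
  multiplicity when the server averages.
\<close>

definition fats_step ::
    "('a::euclidean_space \<Rightarrow> 'x \<Rightarrow> real) \<Rightarrow> real \<Rightarrow> nat \<Rightarrow> nat \<Rightarrow> nat \<Rightarrow> nat \<Rightarrow> 'x dataset \<Rightarrow>
     nat \<Rightarrow> ('a, 'x) iteration \<Rightarrow> ('a, 'x) iteration pmf" where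
  "fats_step f \<eta> T E K b D t prev = do {
     P \<leftarrow> (if t \<in> round_starts T E then sample_with_replacement K (dom D)
          else return_pmf (sampled_clients prev));
     B \<leftarrow> Pi_pmf (set_mset P) {#} (\<lambda>k. sample_without_replacement b (the (D k)));
     let \<theta>old = (\<lambda>k. if t \<in> round_starts T E then global_model prev
                     else the (local_models prev k));
         \<theta>new = (\<lambda>k. \<theta>old k - \<eta> *\<^sub>R (1 / real b) *\<^sub>R
                      (\<Sum>X\<in>#B k. grad (\<lambda>\<theta>. f \<theta> X) (\<theta>old k)));
         \<theta>glob = (if t mod E = 0 then (1 / real K) *\<^sub>R (\<Sum>k\<in>#P. \<theta>new k)
                  else global_model prev)
     in return_pmf (Iteration P B (\<lambda>k. if k \<in># P then Some (\<theta>new k) else None) \<theta>glob)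
   }"

text \<open>
  The complete history up to iteration \<open>t\<close>, latest iteration first; the last entry is a dummy
  iteration 0 that carries the initial global model \<open>\<theta>0\<close>.
\<close>

primrec fats_history ::
    "('a::euclidean_space \<Rightarrow> 'x \<Rightarrow> real) \<Rightarrow> real \<Rightarrow> nat \<Rightarrow> nat \<Rightarrow> nat \<Rightarrow> nat \<Rightarrow> 'a \<Rightarrow> 'x dataset \<Rightarrow>
     nat \<Rightarrow> ('a, 'x) iteration list pmf" where
  "fats_history f \<eta> T E K b \<theta>0 D 0 =
     return_pmf [Iteration {#} (\<lambda>_. {#}) Map.empty \<theta>0]"
| "fats_history f \<eta> T E K b \<theta>0 D (Suc t) = do {
     h \<leftarrow> fats_history f \<eta> T E K b \<theta>0 D t;
     r \<leftarrow> fats_step f \<eta> T E K b D (Suc t) (hd h);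
     return_pmf (r # h)
   }"

definition fats ::
    "('a::euclidean_space \<Rightarrow> 'x \<Rightarrow> real) \<Rightarrow> real \<Rightarrow> nat \<Rightarrow> nat \<Rightarrow> nat \<Rightarrow> nat \<Rightarrow> 'a \<Rightarrow> 'x dataset \<Rightarrow>
     ('a \<times> ('a, 'x) iteration list) measure" where
  "fats f \<eta> T E K b \<theta>0 D =
     measure_pmf (map_pmf (\<lambda>h. (global_model (hd h), h)) (fats_history f \<eta> T E K b \<theta>0 D T))"

end

theory Submission
  imports Defs
begin

text \<open>
  The total variation distance between the two histories grows in each iteration by at most the
  expected distance between the two transition kernels, where the expectation may be taken under
  the law of either history.

  For a deleted sample of client \<open>k\<close>, take the expectation under the history on the full dataset.
  The kernels differ only if \<open>k\<close> takes part, which has probability at most \<open>K / M\<close>, and then by at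
  most \<open>b / N\<close>, so the total is at most \<open>T * (K / M) * (b / N) = \<rho>\<^sub>S\<close>.

  For a deleted client, take the expectation under the history on the reduced dataset. There \<open>k\<close>
  never takes part, so the kernels differ only in the client sampling at the \<open>R\<close> round starts, and
  the total is at most \<open>R * (K / M) = \<rho>\<^sub>C\<close>.
\<close>

section \<open>Total variation distance of discrete distributions\<close>

abbreviation tv :: "'s pmf \<Rightarrow> 's pmf \<Rightarrow> real" where
  "tv p q \<equiv> tv_dist (measure_pmf p) (measure_pmf q)"

lemma integrable_bounded_pmf:
  fixes h :: "'s \<Rightarrow> real"
  assumes "\<And>x. \<bar>h x\<bar> \<le> B"
  shows "integrable (measure_pmf p) h"
  by (rule measure_pmf.integrable_const_bound[where B = B]) (use assms in auto)

lemma integral_mono_pmf: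
  fixes h g :: "'s \<Rightarrow> real"
  assumes "\<And>x. \<bar>h x\<bar> \<le> B" and "\<And>x. \<bar>g x\<bar> \<le> B'"
    and "\<And>x. x \<in> set_pmf p \<Longrightarrow> h x \<le> g x"
  shows "measure_pmf.expectation p h \<le> measure_pmf.expectation p g"
  by (rule integral_mono_AE)
    (use assms in \<open>auto simp: AE_measure_pmf_iff intro: integrable_bounded_pmf\<close>)

lemma measure_bind_pmf:
  "measure (bind_pmf p f) Z = measure_pmf.expectation p (\<lambda>x. measure (f x) Z)"
  unfolding measure_pmf_bind
  by (rule measure_pmf.measure_bind[where N = "count_space UNIV"])
    (auto simp: measure_pmf_in_subprob_algebra)

lemma abs_measure_pmf_diff_le_1: "\<bar>measure (measure_pmf p) Z - measure (measure_pmf q) Z\<bar> \<le> 1"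
  using measure_pmf.prob_le_1[of p Z] measure_pmf.prob_le_1[of q Z]
    measure_nonneg[of p Z] measure_nonneg[of q Z] by linarith

lemma measure_diff_le_tv: "\<bar>measure (measure_pmf p) Z - measure (measure_pmf q) Z\<bar> \<le> tv p q"
  unfolding tv_dist_def
  by (rule cSUP_upper) (auto intro!: bdd_aboveI[where M = 1] abs_measure_pmf_diff_le_1)

text \<open>Passing from \<open>Z\<close> to its complement flips the sign of the difference, so a
  one-sided bound over all events already controls the absolute value.\<close>

lemma tv_leI:
  assumes "\<And>Z. measure (measure_pmf p) Z - measure (measure_pmf q) Z \<le> e"
  shows "tv p q \<le> e"
  unfolding tv_dist_def
proof (rule cSUP_least)
  fix Z assume "Z \<in> sets (measure_pmf p)"
  have "measure (measure_pmf p) (- Z) - measure (measure_pmf q) (- Z) \<le> e" by fact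
  then show "\<bar>measure (measure_pmf p) Z - measure (measure_pmf q) Z\<bar> \<le> e"
    using assms[of Z] measure_pmf.prob_compl[of Z p] measure_pmf.prob_compl[of Z q]
    by (auto simp: Compl_eq_Diff_UNIV)
qed auto

lemma tv_nonneg: "0 \<le> tv p q"
  using measure_diff_le_tv[of p "{}" q] by simp

lemma tv_le_1: "tv p q \<le> 1"
  by (rule tv_leI) (use abs_measure_pmf_diff_le_1 in \<open>auto simp: abs_le_iff\<close>)

lemma tv_refl [simp]: "tv p p = 0"
  by (rule antisym[OF tv_leI tv_nonneg]) simp

lemma tv_commute: "tv p q = tv q p"
  by (simp add: tv_dist_def abs_minus_commute)

lemma abs_tv_le_1: "\<bar>tv p q\<bar> \<le> 1"
  using tv_le_1[of p q] tv_nonneg[of p q] by linarith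

text \<open>The set of points where \<open>p\<close> has the larger mass attains the supremum.\<close>

lemma expectation_diff_le_tv:
  fixes h :: "'s \<Rightarrow> real"
  assumes h: "\<And>x. 0 \<le> h x" "\<And>x. h x \<le> 1"
  shows "measure_pmf.expectation p h - measure_pmf.expectation q h \<le> tv p q"
proof -
  let ?Z = "{x. pmf q x \<le> pmf p x}"
  \<comment> \<open>Both expectations become integrals against counting measure, so that the
    integrands can be compared point by point.\<close>
  have E: "measure_pmf.expectation r g = (\<integral>x. pmf r x * g x \<partial>count_space UNIV)"
    for r :: "'s pmf" and g :: "'s \<Rightarrow> real"
    by (simp add: measure_pmf_eq_density integral_density)
  have I: "integrable (count_space UNIV) (\<lambda>x. pmf r x * g x)"
    if "\<And>x. 0 \<le> g x" "\<And>x. g x \<le> 1" for r :: "'s pmf" and g :: "'s \<Rightarrow> real"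
    by (rule Bochner_Integration.integrable_bound[OF integrable_pmf[of UNIV r]])
      (use that in \<open>auto simp: abs_mult intro!: mult_left_le\<close>)
  have "measure_pmf.expectation p h - measure_pmf.expectation q h
      = (\<integral>x. pmf p x * h x - pmf q x * h x \<partial>count_space UNIV)"
    unfolding E by (intro Bochner_Integration.integral_diff[symmetric] I h)
  also have "\<dots> \<le> (\<integral>x. pmf p x * indicator ?Z x - pmf q x * indicator ?Z x \<partial>count_space UNIV)"
  proof (intro integral_mono Bochner_Integration.integrable_diff I h)
    fix x
    \<comment> \<open>On \<open>?Z\<close> the weight is nonnegative and raising \<open>h x\<close>
      to 1 can only increase the product; off \<open>?Z\<close> it is negative and lowering
      \<open>h x\<close> to 0 does the same.\<close>
    have "(pmf p x - pmf q x) * h x \<le> (pmf p x - pmf q x) * indicator ?Z x"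
      using h[of x] by (cases "x \<in> ?Z") (auto intro: mult_left_le mult_nonpos_nonneg)
    then show "pmf p x * h x - pmf q x * h x
        \<le> pmf p x * indicator ?Z x - pmf q x * indicator ?Z x"
      by (simp add: left_diff_distrib)
  qed auto
  also have "\<dots> = measure_pmf.expectation p (indicator ?Z) - measure_pmf.expectation q (indicator ?Z)"
    unfolding E by (intro Bochner_Integration.integral_diff I) auto
  also have "\<dots> \<le> tv p q"
    using measure_diff_le_tv[of p ?Z q] by simp
  finally show ?thesis .
qed

text \<open>The hybrid \<open>bind_pmf q f\<close> lies in between. Exchanging \<open>p\<close> for
  \<open>q\<close> costs at most \<open>tv p q\<close>, since the probability of an event under
  \<open>f x\<close> is a function of \<open>x\<close> with values in [0,1]; exchanging the kernels
  costs their mean distance. The mean is under the second law, so the order of the arguments selects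
  the law used.\<close>

lemma tv_bind_le:
  "tv (bind_pmf p f) (bind_pmf q g)
     \<le> tv p q + measure_pmf.expectation q (\<lambda>x. tv (f x) (g x))"
proof (rule tv_leI)
  fix Z
  note b = integrable_bounded_pmf[where B = 1]
  have "measure_pmf.expectation p (\<lambda>x. measure (f x) Z)
      - measure_pmf.expectation q (\<lambda>x. measure (f x) Z) \<le> tv p q"
    by (rule expectation_diff_le_tv) auto
  moreover have "measure_pmf.expectation q (\<lambda>x. measure (f x) Z)
      - measure_pmf.expectation q (\<lambda>x. measure (g x) Z)
      = measure_pmf.expectation q (\<lambda>x. measure (f x) Z - measure (g x) Z)"
    by (rule Bochner_Integration.integral_diff[symmetric]) (auto intro!: b)
  moreover have "\<dots> \<le> measure_pmf.expectation q (\<lambda>x. tv (f x) (g x))"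
    by (rule integral_mono_pmf[of _ 1 _ 1])
      (auto simp: abs_measure_pmf_diff_le_1 abs_tv_le_1
        intro: order_trans[OF abs_ge_self measure_diff_le_tv])
  ultimately show "measure (bind_pmf p f) Z - measure (bind_pmf q g) Z
      \<le> tv p q + measure_pmf.expectation q (\<lambda>x. tv (f x) (g x))"
    unfolding measure_bind_pmf by linarith
qed

lemma tv_bind_le_const:
  assumes "\<And>x. x \<in> set_pmf q \<Longrightarrow> tv (f x) (g x) \<le> e"
  shows "tv (bind_pmf p f) (bind_pmf q g) \<le> tv p q + e"
proof -
  have "measure_pmf.expectation q (\<lambda>x. tv (f x) (g x)) \<le> measure_pmf.expectation q (\<lambda>_. e)"
    by (rule integral_mono_pmf[of _ 1 _ "\<bar>e\<bar>"]) (auto simp: abs_tv_le_1 assms)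
  then show ?thesis
    using tv_bind_le[of p f q g] by simp
qed

lemma tv_bind_same_le: "tv (bind_pmf p f) (bind_pmf q f) \<le> tv p q"
  using tv_bind_le_const[of q f f 0 p] by simp

lemma tv_map_le: "tv (map_pmf f p) (map_pmf f q) \<le> tv p q"
  unfolding map_pmf_def by (rule tv_bind_same_le)

text \<open>Each of the \<open>n\<close> independent draws contributes one term
  \<open>tv p q\<close>.\<close>

lemma tv_replicate_le: "tv (replicate_pmf n p) (replicate_pmf n q) \<le> real n * tv p q"
proof (induction n)
  case (Suc n)
  have "tv (replicate_pmf (Suc n) p) (replicate_pmf (Suc n) q) \<le> tv p q + real n * tv p q"
    unfolding replicate_pmf.simps
    by (intro tv_bind_le_const order_trans[OF tv_bind_same_le] Suc.IH)
  then show ?case by (simp add: algebra_simps)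
qed simp

text \<open>Only coordinate \<open>k\<close> can differ. Drawing it first makes the remaining
  coordinates a common kernel, which cannot increase the distance.\<close>

lemma tv_Pi_pmf_le:
  assumes "finite A" and "\<And>x. x \<in> A \<Longrightarrow> x \<noteq> k \<Longrightarrow> p x = q x"
  shows "tv (Pi_pmf A d p) (Pi_pmf A d q) \<le> (if k \<in> A then tv (p k) (q k) else 0)"
proof (cases "k \<in> A")
  case False
  then have "Pi_pmf A d p = Pi_pmf A d q"
    using assms(2) by (intro Pi_pmf_cong) auto
  with False show ?thesis by simp
next
  case True
  have "Pi_pmf (A - {k}) d p = Pi_pmf (A - {k}) d q"
    using assms(2) by (intro Pi_pmf_cong) auto
  moreover have "Pi_pmf A d r = bind_pmf (r k) (\<lambda>y. map_pmf (\<lambda>f. f(k := y)) (Pi_pmf (A - {k}) d r))"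
    for r
    using Pi_pmf_insert'[of "A - {k}" k d r] True assms(1)
    by (simp add: insert_absorb map_pmf_def)
  ultimately show ?thesis
    using True by (simp add: tv_bind_same_le)
qed


section \<open>Sampling after a deletion\<close>

text \<open>A uniform draw hits one distinguished copy of \<open>X\<close> with probability
  \<open>1 / size A\<close> and is otherwise uniform on the rest, which may contain further copies
  of \<open>X\<close>.\<close>

lemma pmf_of_multiset_delete_mixture:
  assumes "X \<in># A" and "A \<noteq> {#X#}"
  shows "pmf_of_multiset A = bind_pmf (bernoulli_pmf (1 / real (size A)))
           (\<lambda>c. if c then return_pmf X else pmf_of_multiset (A - {#X#}))"
proof (rule pmf_eqI)
  fix y
  obtain B where B: "A = add_mset X B"
    using assms(1) by (meson mset_add)
  with assms(2) have "B \<noteq> {#}" by auto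
  then have "real (size B) > 0" by (simp add: nonempty_has_size)
  moreover from this have "1 - 1 / (1 + real (size B)) = real (size B) / (1 + real (size B))"
    by (simp add: field_simps)
  ultimately show "pmf (pmf_of_multiset A) y = pmf (bind_pmf (bernoulli_pmf (1 / real (size A)))
           (\<lambda>c. if c then return_pmf X else pmf_of_multiset (A - {#X#}))) y"
    using B \<open>B \<noteq> {#}\<close>
    by (auto simp: pmf_bind indicator_def add_divide_distrib)
qed

text \<open>Induction on the number of draws. With \<open>size A = m + 1\<close>, the first draw
  hits the deleted copy with probability \<open>1 / (m + 1)\<close>, at cost at most 1; otherwise
  both samplers continue from the same point with cost at most \<open>n / m\<close>. Altogether this
  gives \<open>(n + 1) / (m + 1)\<close>.\<close>

lemma tv_sample_without_replacement_le:
  assumes "X \<in># A"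
  shows "tv (sample_without_replacement n A) (sample_without_replacement n (A - {#X#}))
           \<le> real n / real (size A)"
  using assms
proof (induction n arbitrary: A)
  case (Suc n)
  show ?case
  proof (cases "A = {#X#}")
    \<comment> \<open>The reduced multiset is empty and its sampling law unspecified, but the
      claimed bound is then at least 1.\<close>
    case True
    then show ?thesis
      by (auto intro: order_trans[OF tv_le_1])
  next
    case False
    define m where "m = real (size A) - 1"
    let ?p = "bernoulli_pmf (1 / real (size A))"
    let ?draw = "\<lambda>S Y. bind_pmf (sample_without_replacement n (S - {#Y#})) (\<lambda>B. return_pmf (add_mset Y B))"
    \<comment> \<open>Both laws are mixtures over the same coin, where \<open>True\<close> means
      that the first draw from \<open>A\<close> hits the deleted copy; \<open>?G\<close> ignores the
      coin.\<close>
    let ?F = "\<lambda>c. bind_pmf (if c then return_pmf X else pmf_of_multiset (A - {#X#})) (?draw A)"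
    let ?G = "\<lambda>c::bool. bind_pmf (pmf_of_multiset (A - {#X#})) (?draw (A - {#X#}))"
    from Suc.prems obtain A' where A': "A = add_mset X A'"
      by (meson mset_add)
    with False have "A' \<noteq> {#}" by auto
    then have m: "m > 0" "real (size A) = m + 1" "real (size A') = m"
      using A' by (auto simp: m_def nonempty_has_size)
    have G: "tv (?F False) (?G False) \<le> real n / m"
    proof -
      have "tv (?F False) (?G False) \<le> tv (pmf_of_multiset (A - {#X#})) (pmf_of_multiset (A - {#X#})) + real n / m"
        unfolding if_False
      proof (intro tv_bind_le_const order_trans[OF tv_bind_same_le])
        \<comment> \<open>The point \<open>Y\<close> comes from the other copies, so
          \<open>X\<close> is still present after its removal, even if \<open>Y = X\<close>. The two
          deletions commute, and the induction hypothesis applies to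
          \<open>A - {#Y#}\<close>.\<close>
        fix Y assume "Y \<in> set_pmf (pmf_of_multiset (A - {#X#}))"
        then have Y: "Y \<in># A'"
          using A' \<open>A' \<noteq> {#}\<close> by simp
        then have "X \<in># A - {#Y#}" and s: "real (size (A - {#Y#})) = m"
          using A' m by (auto simp: size_Diff_singleton)
        from Suc.IH[OF this(1)] show "tv (sample_without_replacement n (A - {#Y#}))
            (sample_without_replacement n (A - {#X#} - {#Y#})) \<le> real n / m"
          unfolding s by (simp add: add_mset_commute)
      qed
      then show ?thesis by simp
    qed
    have p: "0 \<le> 1 / real (size A)" "1 / real (size A) \<le> 1"
      using m by auto
    have "tv (sample_without_replacement (Suc n) A) (sample_without_replacement (Suc n) (A - {#X#}))
        = tv (bind_pmf ?p ?F) (bind_pmf ?p ?G)"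
      unfolding bind_assoc_pmf[symmetric]
        pmf_of_multiset_delete_mixture[OF Suc.prems False, symmetric]
      by simp
    also have "\<dots> \<le> measure_pmf.expectation ?p (\<lambda>c. tv (?F c) (?G c))"
      using tv_bind_le[of ?p ?F ?p ?G] by simp
    also have "\<dots> = tv (?F True) (?G True) * (1 / real (size A))
        + tv (?F False) (?G False) * (1 - 1 / real (size A))"
      by (rule integral_bernoulli_pmf[OF p])
    also have "\<dots> \<le> 1 * (1 / real (size A)) + real n / m * (1 - 1 / real (size A))"
      using p by (intro add_mono mult_right_mono tv_le_1 G) auto
    also have "\<dots> = real (Suc n) / real (size A)"
      using m by (simp add: field_simps)
    finally show ?thesis .
  qed
qed simp

lemma tv_pmf_of_multiset_delete_le:
  assumes "X \<in># A" and "A \<noteq> {#X#}"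
  shows "tv (pmf_of_multiset A) (pmf_of_multiset (A - {#X#})) \<le> 1 / real (size A)"
proof -
  let ?p = "bernoulli_pmf (1 / real (size A))" and ?q = "pmf_of_multiset (A - {#X#})"
  let ?F = "\<lambda>c. if c then return_pmf X else ?q"
  have p: "0 \<le> 1 / real (size A)" "1 / real (size A) \<le> 1"
    using assms(1) by (auto simp: divide_le_eq_1 Suc_le_eq nonempty_has_size)
  have "tv (pmf_of_multiset A) ?q = tv (bind_pmf ?p ?F) (bind_pmf ?p (\<lambda>_. ?q))"
    unfolding pmf_of_multiset_delete_mixture[OF assms, symmetric] by simp
  also have "\<dots> \<le> measure_pmf.expectation ?p (\<lambda>c. tv (?F c) ?q)"
    using tv_bind_le[of ?p ?F ?p "\<lambda>_. ?q"] by simp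
  also have "\<dots> = tv (return_pmf X) ?q * (1 / real (size A))"
    using integral_bernoulli_pmf[OF p, of "\<lambda>c. tv (?F c) ?q"] by simp
  also have "\<dots> \<le> 1 * (1 / real (size A))"
    using p by (intro mult_right_mono tv_le_1) auto
  finally show ?thesis by simp
qed

text \<open>A set is a multiset without repetitions, so the multiset bound carries over;
  \<open>C \<noteq> {k}\<close> keeps the reduced law well defined.\<close>

lemma tv_pmf_of_set_delete_le:
  assumes "finite C" and "k \<in> C" and "C \<noteq> {k}"
  shows "tv (pmf_of_set C) (pmf_of_set (C - {k})) \<le> 1 / real (card C)"
proof -
  have eq: "pmf_of_set S = pmf_of_multiset (mset_set S)" if "finite S" "S \<noteq> {}" for S
    using that
    by (intro pmf_eqI) (auto simp: mset_set_empty_iff indicator_def)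
  have "mset_set C \<noteq> {#k#}"
    using assms by (metis finite_set_mset_mset_set set_mset_single)
  moreover have "C - {k} \<noteq> {}" "C \<noteq> {}"
    using assms(2,3) by auto
  ultimately show ?thesis
    using tv_pmf_of_multiset_delete_le[of k "mset_set C"] assms eq[of C] eq[of "C - {k}"]
    by (simp add: mset_set_Diff)
qed

lemma tv_sample_with_replacement_le:
  assumes "finite C" and "k \<in> C" and "C \<noteq> {k}"
  shows "tv (sample_with_replacement n C) (sample_with_replacement n (C - {k}))
           \<le> real n / real (card C)"
proof -
  have "tv (sample_with_replacement n C) (sample_with_replacement n (C - {k}))
      \<le> real n * tv (pmf_of_set C) (pmf_of_set (C - {k}))"
    unfolding sample_with_replacement_def by (intro order_trans[OF tv_map_le] tv_replicate_le)
  also have "\<dots> \<le> real n * (1 / real (card C))"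
    by (intro mult_left_mono tv_pmf_of_set_delete_le assms) auto
  finally show ?thesis by simp
qed

text \<open>A union bound over the \<open>n\<close> draws, obtained by splitting off the first
  one.\<close>

lemma measure_replicate_pmf_le:
  "measure (replicate_pmf n p) {xs. x \<in> set xs} \<le> real n * pmf p x"
proof (induction n)
  case (Suc n)
  have "measure (replicate_pmf (Suc n) p) {xs. x \<in> set xs}
      = measure_pmf.expectation p (\<lambda>y. measure (replicate_pmf n p) {xs. x = y \<or> x \<in> set xs})"
    by (simp add: measure_bind_pmf vimage_def flip: map_pmf_def)
  also have "\<dots> \<le> measure_pmf.expectation p (\<lambda>y. indicator {x} y + real n * pmf p x)"
  proof (rule integral_mono_pmf[of _ 1 _ "1 + real n * pmf p x"])
    fix y
    show "measure (replicate_pmf n p) {xs. x = y \<or> x \<in> set xs} \<le> indicator {x} y + real n * pmf p x"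
      using Suc.IH by (cases "x = y") auto
  qed (auto simp: indicator_def)
  also have "\<dots> = pmf p x + real n * pmf p x"
    by (subst Bochner_Integration.integral_add)
      (auto simp: pmf.rep_eq intro!: integrable_bounded_pmf[where B = 1])
  finally show ?case by (simp add: algebra_simps)
qed simp

lemma measure_sample_with_replacement_le:
  assumes "finite C" and "k \<in> C"
  shows "measure (sample_with_replacement n C) {P. k \<in># P} \<le> real n / real (card C)"
proof -
  have "C \<noteq> {}" using assms(2) by auto
  then show ?thesis
    using measure_replicate_pmf_le[of n "pmf_of_set C" k] assms
    by (simp add: sample_with_replacement_def vimage_def)
qed

lemma set_mset_sample_with_replacement:
  assumes "finite C" and "C \<noteq> {}" and "P \<in> set_pmf (sample_with_replacement n C)"
  shows "set_mset P \<subseteq> C"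
  using assms by (auto simp: sample_with_replacement_def set_replicate_pmf lists_eq_set)


section \<open>Transitions of FATS\<close>

text \<open>This law and \<open>batch_law\<close> are the two random stages of an iteration,
  isolated because the dataset influences \<open>fats_step\<close> through them alone.\<close>

definition client_law where
  "client_law T E K D t prev =
     (if t \<in> round_starts T E then sample_with_replacement K (dom D)
      else return_pmf (sampled_clients prev))"

definition batch_law where
  "batch_law b D P = Pi_pmf (set_mset P) {#} (\<lambda>k. sample_without_replacement b (the (D k)))"

text \<open>Once clients and mini-batches are drawn, the rest of the iteration is deterministic. The
  map \<open>F\<close> is chosen before \<open>D\<close> is quantified, so it serves both
  neighbouring datasets.\<close>

lemma fats_step_eq:
  "\<exists>F. (\<forall>P B. sampled_clients (F P B) = P) \<and>
       (\<forall>D. fats_step f \<eta> T E K b D t prev =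
              bind_pmf (client_law T E K D t prev) (\<lambda>P. map_pmf (F P) (batch_law b D P)))"
  unfolding fats_step_def client_law_def[symmetric] batch_law_def[symmetric] map_pmf_def Let_def
  \<comment> \<open>The holes stand for the local models and the global model;
    \<open>rule refl\<close> fills them by unification with the unfolded step.\<close>
  by (rule exI[where x = "\<lambda>P B. Iteration P B (_ P B) (_ P B)"], intro conjI allI) (simp, rule refl)

lemma fats_step_clients:
  "map_pmf sampled_clients (fats_step f \<eta> T E K b D t prev) = client_law T E K D t prev"
proof -
  obtain F where F: "\<And>P B. sampled_clients (F P B) = P"
    and "fats_step f \<eta> T E K b D t prev =
           bind_pmf (client_law T E K D t prev) (\<lambda>P. map_pmf (F P) (batch_law b D P))"
    using fats_step_eq[of f \<eta> T E K b t prev] by metis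
  then show ?thesis
    by (simp add: map_bind_pmf pmf.map_comp o_def F bind_return_pmf')
qed

text \<open>The common map \<open>F P\<close> is mere post-processing and cannot increase the
  distance, so only the two sampling stages are charged.\<close>

lemma tv_fats_step_le:
  "tv (fats_step f \<eta> T E K b D t prev) (fats_step f \<eta> T E K b D' t prev)
     \<le> tv (client_law T E K D t prev) (client_law T E K D' t prev)
       + measure_pmf.expectation (client_law T E K D' t prev)
           (\<lambda>P. tv (batch_law b D P) (batch_law b D' P))"
proof -
  obtain F where F: "\<And>D. fats_step f \<eta> T E K b D t prev =
      bind_pmf (client_law T E K D t prev) (\<lambda>P. map_pmf (F P) (batch_law b D P))"
    using fats_step_eq[of f \<eta> T E K b t prev] by metis
  have "measure_pmf.expectation (client_law T E K D' t prev)
        (\<lambda>P. tv (map_pmf (F P) (batch_law b D P)) (map_pmf (F P) (batch_law b D' P)))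
      \<le> measure_pmf.expectation (client_law T E K D' t prev)
          (\<lambda>P. tv (batch_law b D P) (batch_law b D' P))"
    by (rule integral_mono_pmf[of _ 1 _ 1]) (auto simp: abs_tv_le_1 tv_map_le)
  then show ?thesis
    unfolding F by (rule order_trans[OF tv_bind_le add_left_mono])
qed

text \<open>The error of the new step is weighted by the history on the second dataset. The two
  deletion bounds below therefore list their datasets in opposite orders: the full one second for a
  sample, the reduced one second for a client.\<close>

lemma tv_fats_history_Suc_le:
  "tv (fats_history f \<eta> T E K b \<theta>0 D (Suc t)) (fats_history f \<eta> T E K b \<theta>0 D' (Suc t))
     \<le> tv (fats_history f \<eta> T E K b \<theta>0 D t) (fats_history f \<eta> T E K b \<theta>0 D' t)
       + measure_pmf.expectation (fats_history f \<eta> T E K b \<theta>0 D' t)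
           (\<lambda>h. tv (fats_step f \<eta> T E K b D (Suc t) (hd h)) (fats_step f \<eta> T E K b D' (Suc t) (hd h)))"
  unfolding fats_history.simps
  by (intro order_trans[OF tv_bind_le] add_left_mono integral_mono_pmf[of _ 1 _ 1])
    (auto simp: abs_tv_le_1 tv_bind_same_le)

lemma fats_history_Suc_clients:
  "map_pmf (\<lambda>h. sampled_clients (hd h)) (fats_history f \<eta> T E K b \<theta>0 D (Suc t))
     = bind_pmf (fats_history f \<eta> T E K b \<theta>0 D t) (\<lambda>h. client_law T E K D (Suc t) (hd h))"
  by (simp add: map_bind_pmf pmf.map_comp o_def fats_step_clients flip: map_pmf_def)

lemma tv_fats_le:
  "tv_dist (fats f \<eta> T E K b \<theta>0 D) (fats f \<eta> T E K b \<theta>0 D')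
     \<le> tv (fats_history f \<eta> T E K b \<theta>0 D T) (fats_history f \<eta> T E K b \<theta>0 D' T)"
  unfolding fats_def by (rule tv_map_le)


section \<open>Deleting a sample\<close>

text \<open>The dummy iteration 0 has no clients. A round start draws afresh, where the union bound
  applies; any other iteration keeps the previous multiset and hence the probability.\<close>

lemma measure_fats_history_client_le:
  assumes "finite (dom D)" and "k \<in> dom D"
  shows "measure (fats_history f \<eta> T E K b \<theta>0 D t) {h. k \<in># sampled_clients (hd h)}
           \<le> real K / real (card (dom D))"
proof (induction t)
  case (Suc t)
  let ?H = "fats_history f \<eta> T E K b \<theta>0 D t"
  have "measure (fats_history f \<eta> T E K b \<theta>0 D (Suc t)) {h. k \<in># sampled_clients (hd h)}
      = measure (map_pmf (\<lambda>h. sampled_clients (hd h)) (fats_history f \<eta> T E K b \<theta>0 D (Suc t)))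
          {P. k \<in># P}"
    by (simp add: vimage_def del: fats_history.simps)
  also have "\<dots> = measure_pmf.expectation ?H
      (\<lambda>h. measure (client_law T E K D (Suc t) (hd h)) {P. k \<in># P})"
    unfolding fats_history_Suc_clients measure_bind_pmf ..
  also have "\<dots> \<le> real K / real (card (dom D))"
  proof (cases "Suc t \<in> round_starts T E")
    case True
    then show ?thesis
      by (simp add: client_law_def measure_sample_with_replacement_le[OF assms])
  next
    case False
    then have eq: "(\<lambda>h. measure (client_law T E K D (Suc t) (hd h)) {P. k \<in># P})
        = indicator {h. k \<in># sampled_clients (hd h)}"
      by (auto simp: client_law_def fun_eq_iff indicator_def)
    show ?thesis using Suc.IH unfolding eq by simp
  qed
  finally show ?case .
qed simp

lemma tv_fats_history_delete_sample_le:
  assumes fin: "finite (dom D)" and k: "k \<in> dom D" and X: "X \<in># the (D k)"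
  shows "tv (fats_history f \<eta> T E K b \<theta>0 (delete_sample k X D) t) (fats_history f \<eta> T E K b \<theta>0 D t)
           \<le> real t * (real b / real (size (the (D k))) * (real K / real (card (dom D))))"
proof (induction t)
  case (Suc t)
  let ?D = "delete_sample k X D"
  let ?\<beta> = "real b / real (size (the (D k)))"
  let ?H = "fats_history f \<eta> T E K b \<theta>0 D t"
  have batch: "tv (batch_law b ?D P) (batch_law b D P) \<le> ?\<beta> * indicator {P. k \<in># P} P" for P
  proof -
    have "tv (batch_law b ?D P) (batch_law b D P) \<le> (if k \<in> set_mset P then
        tv (sample_without_replacement b (the (?D k))) (sample_without_replacement b (the (D k))) else 0)"
      unfolding batch_law_def by (rule tv_Pi_pmf_le) (auto simp: delete_sample_def)
    also have "\<dots> \<le> ?\<beta> * indicator {P. k \<in># P} P"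
      using tv_sample_without_replacement_le[OF X, of b]
      by (auto simp: delete_sample_def tv_commute)
    finally show ?thesis .
  qed
  \<comment> \<open>Client \<open>k\<close> remains available even if its local dataset becomes
    empty, so the client sampling is unaffected.\<close>
  have dom: "dom ?D = dom D"
    using k by (auto simp: delete_sample_def)
  have step: "tv (fats_step f \<eta> T E K b ?D t' prev) (fats_step f \<eta> T E K b D t' prev)
      \<le> ?\<beta> * measure (client_law T E K D t' prev) {P. k \<in># P}" for t' prev
  proof -
    have "measure_pmf.expectation (client_law T E K D t' prev) (\<lambda>P. tv (batch_law b ?D P) (batch_law b D P))
        \<le> measure_pmf.expectation (client_law T E K D t' prev) (\<lambda>P. ?\<beta> * indicator {P. k \<in># P} P)"
      by (rule integral_mono_pmf[of _ 1 _ ?\<beta>]) (rule abs_tv_le_1, simp add: indicator_def, rule batch)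
    moreover have "client_law T E K ?D t' prev = client_law T E K D t' prev"
      by (simp add: client_law_def dom)
    ultimately show ?thesis
      using tv_fats_step_le[of f \<eta> T E K b ?D t' prev D] by simp
  qed
  have "measure_pmf.expectation ?H
        (\<lambda>h. tv (fats_step f \<eta> T E K b ?D (Suc t) (hd h)) (fats_step f \<eta> T E K b D (Suc t) (hd h)))
      \<le> measure_pmf.expectation ?H
        (\<lambda>h. ?\<beta> * measure (client_law T E K D (Suc t) (hd h)) {P. k \<in># P})"
  proof (rule integral_mono_pmf[of _ 1 _ ?\<beta>])
    fix h
    show "\<bar>?\<beta> * measure (client_law T E K D (Suc t) (hd h)) {P. k \<in># P}\<bar> \<le> ?\<beta>"
      unfolding abs_mult by (simp add: mult_left_le del: times_divide_eq_left)
  qed (rule abs_tv_le_1, rule step)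
  \<comment> \<open>Averaging the conditional participation probability over the history gives the
    unconditional one at iteration \<open>Suc t\<close>, which is already bounded.\<close>
  also have "\<dots> = ?\<beta> * measure (map_pmf (\<lambda>h. sampled_clients (hd h))
      (fats_history f \<eta> T E K b \<theta>0 D (Suc t))) {P. k \<in># P}"
    unfolding fats_history_Suc_clients measure_bind_pmf by simp
  also have "\<dots> \<le> ?\<beta> * (real K / real (card (dom D)))"
    using measure_fats_history_client_le[OF fin k, of f \<eta> T E K b \<theta>0 "Suc t"]
    by (intro mult_left_mono) (simp_all add: vimage_def del: fats_history.simps)
  finally have "measure_pmf.expectation ?H
      (\<lambda>h. tv (fats_step f \<eta> T E K b ?D (Suc t) (hd h)) (fats_step f \<eta> T E K b D (Suc t) (hd h)))
      \<le> ?\<beta> * (real K / real (card (dom D)))" .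
  then show ?case
    using Suc.IH tv_fats_history_Suc_le[of f \<eta> T E K b \<theta>0 ?D t D]
    by (simp add: distrib_right add_divide_distrib del: fats_history.simps)
qed simp


section \<open>Deleting a client\<close>

lemma fats_history_clients_subset:
  assumes "finite (dom D)" and "dom D \<noteq> {}" and "h \<in> set_pmf (fats_history f \<eta> T E K b \<theta>0 D t)"
  shows "set_mset (sampled_clients (hd h)) \<subseteq> dom D"
  using assms(3)
proof (induction t arbitrary: h)
  case (Suc t)
  have "sampled_clients (hd h)
      \<in> set_pmf (map_pmf (\<lambda>h. sampled_clients (hd h)) (fats_history f \<eta> T E K b \<theta>0 D (Suc t)))"
    using Suc.prems by (simp del: fats_history.simps)
  then obtain h' where "h' \<in> set_pmf (fats_history f \<eta> T E K b \<theta>0 D t)"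
    and "sampled_clients (hd h) \<in> set_pmf (client_law T E K D (Suc t) (hd h'))"
    unfolding fats_history_Suc_clients by auto
  then show ?case
    using Suc.IH[of h'] set_mset_sample_with_replacement[OF assms(1,2)]
    by (auto simp: client_law_def split: if_splits)
qed simp

text \<open>Histories on the reduced dataset never involve \<open>k\<close>, so mini-batches cost
  nothing and only iterations with fresh client sampling are counted.\<close>

lemma tv_fats_history_delete_client_le:
  assumes fin: "finite (dom D)" and k: "k \<in> dom D" and ne: "dom D \<noteq> {k}"
  shows "tv (fats_history f \<eta> T E K b \<theta>0 D t) (fats_history f \<eta> T E K b \<theta>0 (D |` (dom D - {k})) t)
           \<le> real (card ({1..t} \<inter> round_starts T E)) * (real K / real (card (dom D)))"
proof (induction t)
  case (Suc t)
  let ?D = "D |` (dom D - {k})"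
  let ?\<kappa> = "real K / real (card (dom D))"
  let ?\<epsilon> = "if Suc t \<in> round_starts T E then ?\<kappa> else 0"
  let ?H = "fats_history f \<eta> T E K b \<theta>0 ?D t"
  have dom: "dom ?D = dom D - {k}" by auto
  have step: "tv (fats_step f \<eta> T E K b D (Suc t) (hd h)) (fats_step f \<eta> T E K b ?D (Suc t) (hd h)) \<le> ?\<epsilon>"
    if h: "h \<in> set_pmf ?H" for h
  proof -
    \<comment> \<open>A multiset drawn afresh avoids \<open>k\<close> by the choice of the sampling
      set, a carried-over one by the support of \<open>?H\<close>.\<close>
    have "set_mset P \<subseteq> dom D - {k}" if "P \<in> set_pmf (client_law T E K ?D (Suc t) (hd h))" for P
      using that set_mset_sample_with_replacement[of "dom ?D" P K]
        fats_history_clients_subset[OF _ _ h] fin k ne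
      by (auto simp: client_law_def dom split: if_splits)
    then have "tv (batch_law b D P) (batch_law b ?D P) \<le> 0"
      if "P \<in> set_pmf (client_law T E K ?D (Suc t) (hd h))" for P
      using tv_Pi_pmf_le[of "set_mset P" k] that unfolding batch_law_def
      by (smt (verit) Diff_iff finite_set_mset restrict_in singletonI subsetD)
    then have "measure_pmf.expectation (client_law T E K ?D (Suc t) (hd h))
          (\<lambda>P. tv (batch_law b D P) (batch_law b ?D P))
        \<le> measure_pmf.expectation (client_law T E K ?D (Suc t) (hd h)) (\<lambda>_. 0)"
      by (intro integral_mono_pmf[of _ 1 _ 0]) (auto simp: abs_tv_le_1)
    \<comment> \<open>Away from round starts both client laws are the same point mass, since they
      continue from the same history \<open>h\<close>.\<close>
    moreover have "tv (client_law T E K D (Suc t) (hd h)) (client_law T E K ?D (Suc t) (hd h)) \<le> ?\<epsilon>"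
      using tv_sample_with_replacement_le[OF fin k ne, of K] by (simp add: client_law_def dom del: dom_restrict)
    ultimately show ?thesis
      using tv_fats_step_le[of f \<eta> T E K b D "Suc t" "hd h" ?D] by simp
  qed
  have "measure_pmf.expectation ?H
        (\<lambda>h. tv (fats_step f \<eta> T E K b D (Suc t) (hd h)) (fats_step f \<eta> T E K b ?D (Suc t) (hd h)))
      \<le> measure_pmf.expectation ?H (\<lambda>_. ?\<epsilon>)"
    by (rule integral_mono_pmf[of _ 1 _ ?\<kappa>]) (auto simp: abs_tv_le_1 step)
  moreover have "real (card ({1..Suc t} \<inter> round_starts T E)) * ?\<kappa>
      = real (card ({1..t} \<inter> round_starts T E)) * ?\<kappa> + ?\<epsilon>"
    by (simp add: atLeastAtMostSuc_conv Int_insert_left distrib_right add_divide_distrib)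
  ultimately show ?case
    using Suc.IH tv_fats_history_Suc_le[of f \<eta> T E K b \<theta>0 D t ?D]
    by (simp del: fats_history.simps)
qed simp

text \<open>The index \<open>s\<close> is at most \<open>(R * E - 1) div E\<close>, which is below
  \<open>R\<close> thanks to the subtraction of 1.\<close>

lemma card_round_starts_le:
  assumes "E > 0" and "R > 0"
  shows "card ({1..R * E} \<inter> round_starts (R * E) E) \<le> R"
proof -
  have "R * E - 1 < R * E" using assms by simp
  then have "(R * E - 1) div E < R"
    using less_mult_imp_div_less by blast
  then have "round_starts (R * E) E \<subseteq> (\<lambda>s. s * E + 1) ` {..<R}"
    by (auto simp: round_starts_def)
  then have "card ({1..R * E} \<inter> round_starts (R * E) E) \<le> card ((\<lambda>s. s * E + 1) ` {..<R})"
    by (intro card_mono) auto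
  also have "\<dots> \<le> R"
    using card_image_le[of "{..<R}" "\<lambda>s. s * E + 1"] by simp
  finally show ?thesis .
qed


theorem lemma1:
  fixes f :: "'a::euclidean_space \<Rightarrow> 'x \<Rightarrow> real"
    and \<eta> \<rho>\<^sub>S \<rho>\<^sub>C :: real
    and M N R E T K b :: nat
    and \<theta>0 :: 'a
  assumes "\<And>X \<theta>. (\<lambda>\<theta>. f \<theta> X) differentiable (at \<theta>)"
    and "\<rho>\<^sub>S \<in> {0<..1}" and "\<rho>\<^sub>C \<in> {0<..1}"
    and "T = R * E"
    and "real K = \<rho>\<^sub>C * real E * real M / real T" and "K > 0"
    and "real b = \<rho>\<^sub>S * real N / (\<rho>\<^sub>C * real E)" and "b > 0"
  shows "sample_level_TV_stable M N (fats f \<eta> T E K b \<theta>0) (min \<rho>\<^sub>S 1) \<and>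
         client_level_TV_stable M N (fats f \<eta> T E K b \<theta>0) (min \<rho>\<^sub>C 1)"
proof -
  \<comment> \<open>Division by zero yields 0, so a vanishing parameter would force
    \<open>K = 0\<close> or \<open>b = 0\<close>.\<close>
  have pos: "R > 0" "E > 0" "M > 0" "N > 0"
    using assms(4-8) by (auto intro!: Nat.gr0I split: if_splits)
  then have T: "real T = real R * real E" "real T > 0"
    using assms(4) by auto
  have "\<rho>\<^sub>C > 0" and min: "min \<rho>\<^sub>S 1 = \<rho>\<^sub>S" "min \<rho>\<^sub>C 1 = \<rho>\<^sub>C"
    using assms(2,3) by auto
  \<comment> \<open>From \<open>T = R * E\<close> the participation rate \<open>K / M\<close> equals
    \<open>\<rho>\<^sub>C / R\<close>.\<close>
  have rounds: "real R * (real K / real M) = \<rho>\<^sub>C"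
    using assms(5) T pos by (simp add: field_simps)
  \<comment> \<open>Here \<open>E * b / N\<close> equals
    \<open>\<rho>\<^sub>S / \<rho>\<^sub>C\<close>, and the factor \<open>\<rho>\<^sub>C\<close>
    from \<open>rounds\<close> cancels.\<close>
  have iterations: "real T * (real b / real N * (real K / real M)) = \<rho>\<^sub>S"
  proof -
    have "real T * (real b / real N * (real K / real M))
        = real R * (real K / real M) * (real E * real b / real N)"
      using T by (simp add: mult_ac)
    also have "\<dots> = \<rho>\<^sub>S"
      unfolding rounds using assms(7) pos \<open>\<rho>\<^sub>C > 0\<close> by simp
    finally show ?thesis .
  qed
  have "tv_dist (fats f \<eta> T E K b \<theta>0 D) (fats f \<eta> T E K b \<theta>0 (delete_sample k X D)) \<le> \<rho>\<^sub>S"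
    if D: "full_dataset M N D" and "k \<in> {1..M}" and "X \<in># the (D k)" for D k X
  proof -
    have "dom D = {1..M}" "size (the (D k)) = N"
      using that by (auto simp: full_dataset_def)
    then have "tv (fats_history f \<eta> T E K b \<theta>0 (delete_sample k X D) T) (fats_history f \<eta> T E K b \<theta>0 D T) \<le> \<rho>\<^sub>S"
      using tv_fats_history_delete_sample_le[of D k X f \<eta> T E K b \<theta>0 T] that iterations by auto
    then show ?thesis
      using tv_fats_le[of f \<eta> T E K b \<theta>0 D "delete_sample k X D"] by (simp add: tv_commute)
  qed
  moreover have "tv_dist (fats f \<eta> T E K b \<theta>0 (D |` {1..M})) (fats f \<eta> T E K b \<theta>0 (D |` ({1..M} - {k}))) \<le> \<rho>\<^sub>C"
    if D: "full_dataset M N D" and k: "k \<in> {1..M}" for D k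
  proof (cases "M = 1")
    case True
    \<comment> \<open>Deleting the only client leaves the client sampling unspecified, but then \<open>\<rho>\<^sub>C = R * K \<ge> 1\<close>.\<close>
    then have "\<rho>\<^sub>C = real (R * K)" using rounds by simp
    moreover have "R * K \<ge> 1" using pos assms(6) by (simp add: Suc_le_eq)
    ultimately have "1 \<le> \<rho>\<^sub>C" by linarith
    then show ?thesis
      unfolding fats_def by (rule order_trans[OF tv_le_1])
  next
    case False
    have dom: "dom D = {1..M}" using D by (simp add: full_dataset_def)
    have "D |` dom D = D" by (auto simp: restrict_map_def fun_eq_iff domIff)
    then have restrict: "D |` {1..M} = D" unfolding dom .
    have "{1..M} \<noteq> {k}"
      using False pos by (metis One_nat_def card_atLeastAtMost card.empty card_insert_disjoint
          diff_Suc_1 empty_iff finite.emptyI)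
    then have "tv (fats_history f \<eta> T E K b \<theta>0 D T) (fats_history f \<eta> T E K b \<theta>0 (D |` ({1..M} - {k})) T)
        \<le> real (card ({1..T} \<inter> round_starts T E)) * (real K / real M)"
      using tv_fats_history_delete_client_le[of D k f \<eta> T E K b \<theta>0 T] k dom by simp
    also have "\<dots> \<le> real R * (real K / real M)"
      using card_round_starts_le[of E R] pos assms(4) by (intro mult_right_mono) auto
    finally show ?thesis
      using tv_fats_le[of f \<eta> T E K b \<theta>0 D "D |` ({1..M} - {k})"] rounds
      unfolding restrict by linarith
  qed
  ultimately show ?thesis
    unfolding sample_level_TV_stable_def client_level_TV_stable_def min by blast
qed

end
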